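(* Let $\mathcal H\subset Z_{2^k}^n$ be a linear $1'$-perfect code (with respect to the metric $d^\diamond$). Then $\mathcal H$ is equivalent to $\mathcal H_I$ for some tuple $I=(i_1,\ldots,i_k)$ of nonnegative integers satisfying $1\cdot i_1+2\cdot i_2+\ldots+k\cdot i_k=\log_2 n$.
   Context: Let $k\ge 1$ and let $n$ be a power of two, $n=2^r$. On $Z_{2^k}$ define the weight $wt^\diamond(x)=0$ if $x=0$, $wt^\diamond(x)=1$ if $x$ is odd, $wt^\diamond(x)=2$ if $x\neq0$ is even, and on $Z_{2^k}^n$ the distance $d^\diamond(\bar x,\bar y)=\sum_{i=1}^n wt^\diamond(y_i-x_i)$. Consider the regular bipartite graph on $Z_{2^k}^n$ in which two words are adjacent iff their $d^\diamond$-distance is $1$; its parts are the words with even and with odd $d^\diamond$-weight. A subset $C$ of the even part is called a $1'$-perfect code if every word of the odd part is adjacent to exactly one element of $C$ (equivalently, $|C|$ equals the number of vertices divided by twice the degree, and the graph distance between any two distinct codewords is at least $4$). For a tuple $I=(i_1,\ldots,i_k)$ of nonnegative integers with $1\cdot i_1+2\cdot i_2+\ldots+k\cdot i_k=r$, let $B_I$ be the matrix whose columns $\bar b_1,\ldots,\bar b_n$ are all elements of $\{1\}\times(2^{k-1}Z_{2^k})^{i_1}\times(2^{k-2}Z_{2^k})^{i_2}\times\ldots\times(2^{0}Z_{2^k})^{i_k}$ in lexicographic order, and let $\mathcal H_I=\{\bar h\in Z_{2^k}^n : B_I\bar h^T=\bar 0\}$ be the linear code with parity-check matrix $B_I$.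 Two linear codes $\mathcal C_1,\mathcal C_2\subseteq Z_{2^k}^n$ are called equivalent if $\mathcal C_2=\bar z\circ\pi\mathcal C_1$, where $\pi$ is a permutation of coordinates, $\bar z\in\{1,3,\ldots,2^k-1\}^n$, and $\circ$ is the coordinatewise product $(z_1,\ldots,z_n)\circ(x_1,\ldots,x_n)=(z_1x_1,\ldots,z_nx_n)$. *)

theory Defs
  imports "HOL-Library.Word" "Jordan_Normal_Form.Matrix_Kernel"
begin

text \<open>
  The ring of integers modulo \<open>2^k\<close> is the type \<open>'k word\<close> with \<open>k = LENGTH('k) \<ge> 1\<close>;
  \<open>even\<close> and \<open>odd\<close> are divisibility by 2 in this ring, and \<open>\<le>\<close> is the order
  \<open>0 < 1 < \<dots> < 2^k - 1\<close> of least nonnegative residues.  A word of length \<open>n\<close> is a vector in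
  \<open>carrier_vec n\<close>, with coordinates indexed by \<open>{0..<n}\<close>.
\<close>

definition wt_diamond :: "'k::len word \<Rightarrow> nat" where
  "wt_diamond x = (if x = 0 then 0 else if odd x then 1 else 2)"

definition weight_diamond :: "'k::len word vec \<Rightarrow> nat" where
  "weight_diamond x = (\<Sum>i<dim_vec x. wt_diamond (x $ i))"

definition dist_diamond :: "'k::len word vec \<Rightarrow> 'k word vec \<Rightarrow> nat" where
  "dist_diamond x y = (\<Sum>i<dim_vec x. wt_diamond (y $ i - x $ i))"

definition adjacent :: "'k::len word vec \<Rightarrow> 'k word vec \<Rightarrow> bool" where
  "adjacent x y \<longleftrightarrow> dist_diamond x y = 1"

definition even_part :: "nat \<Rightarrow> 'k::len word vec set" where
  "even_part n = {x \<in> carrier_vec n. even (weight_diamond x)}"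

definition odd_part :: "nat \<Rightarrow> 'k::len word vec set" where
  "odd_part n = {x \<in> carrier_vec n. odd (weight_diamond x)}"

definition one_prime_perfect :: "nat \<Rightarrow> 'k::len word vec set \<Rightarrow> bool" where
  "one_prime_perfect n C \<longleftrightarrow>
     C \<subseteq> even_part n \<and> (\<forall>x \<in> odd_part n. \<exists>!c. c \<in> C \<and> adjacent x c)"

definition linear_code :: "nat \<Rightarrow> 'k::len word vec set \<Rightarrow> bool" where
  "linear_code n C \<longleftrightarrow> submodule class_ring C (module_vec TYPE('k word) n)"

lemma linear_code_iff:
  "linear_code n (C :: 'k::len word vec set) \<longleftrightarrow>
     C \<subseteq> carrier_vec n \<and> 0\<^sub>v n \<in> C \<and> (\<forall>v\<in>C. \<forall>w\<in>C. v + w \<in> C) \<and> (\<forall>c. \<forall>v\<in>C. c \<cdot>\<^sub>v v \<in> C)"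
proof -
  interpret vec_module "TYPE('k word)" n .
  show ?thesis
    using module_axioms by (auto simp: linear_code_def submodule_def module_vec_simps)
qed

definition coord_prod :: "'a::times vec \<Rightarrow> 'a vec \<Rightarrow> 'a vec" (infixl "\<circ>\<^sub>v" 70) where
  "z \<circ>\<^sub>v x = vec (dim_vec x) (\<lambda>i. z $ i * x $ i)"

definition permute_coords :: "(nat \<Rightarrow> nat) \<Rightarrow> 'a vec \<Rightarrow> 'a vec" where
  "permute_coords p x = vec (dim_vec x) (\<lambda>i. x $ p i)"

definition equivalent_codes :: "nat \<Rightarrow> 'k::len word vec set \<Rightarrow> 'k word vec set \<Rightarrow> bool" where
  "equivalent_codes n C1 C2 \<longleftrightarrow>
     (\<exists>p z. p permutes {..<n} \<and> z \<in> carrier_vec n \<and> (\<forall>i<n. odd (z $ i)) \<and>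
        C2 = (\<lambda>x. z \<circ>\<^sub>v permute_coords p x) ` C1)"

definition multiples_list :: "nat \<Rightarrow> 'k::len word list" where
  "multiples_list j = sorted_list_of_set (range (\<lambda>x :: 'k word. 2 ^ (LENGTH('k) - j) * x))"

text \<open>
  The factors of
  \<open>{1} \<times> (2^(k-1) Z)^(I 1) \<times> (2^(k-2) Z)^(I 2) \<times> \<dots> \<times> (2^0 Z)^(I k)\<close>, each as an
  increasing list.  Only the values \<open>I 1, \<dots>, I k\<close> are used.
\<close>

definition column_factors :: "(nat \<Rightarrow> nat) \<Rightarrow> 'k::len word list list" where
  "column_factors I =
     [1] # concat (map (\<lambda>j. replicate (I j) (multiples_list j)) [1..<LENGTH('k) + 1])"

text \<open>
  \<open>product_lists\<close> varies its last factor fastest, so the columns come out in lexicographic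
  order; see \<open>columns_sorted\<close> and \<open>set_columns\<close> below.
\<close>

definition columns :: "(nat \<Rightarrow> nat) \<Rightarrow> 'k::len word list list" where
  "columns I = product_lists (column_factors I)"

definition check_matrix :: "(nat \<Rightarrow> nat) \<Rightarrow> 'k::len word mat" where
  "check_matrix I =
     mat_of_cols (1 + (\<Sum>j=1..LENGTH('k). I j)) (map vec_of_list (columns I))"

definition parity_check_code :: "(nat \<Rightarrow> nat) \<Rightarrow> 'k::len word vec set" where
  "parity_check_code I = mat_kernel (check_matrix I)"

lemma sorted_product_lists:
  assumes "\<forall>xs \<in> set xss. sorted_wrt (<) (xs :: 'a::linorder list)"
  shows "sorted_wrt (\<lambda>a b. (a, b) \<in> lexord {(x, y). x < y}) (product_lists xss)"
  using assms
proof (induction xss)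
  case Nil
  then show ?case by simp
next
  case (Cons xs xss)
  let ?R = "\<lambda>a b. (a, b) \<in> lexord {(x, y). x < (y::'a)}"
  have IH: "sorted_wrt ?R (product_lists xss)" using Cons by simp
  have "sorted_wrt (<) xs" using Cons by simp
  then have "sorted_wrt ?R (concat (map (\<lambda>x. map ((#) x) (product_lists xss)) xs))"
  proof (induction xs)
    case Nil
    then show ?case by simp
  next
    case (Cons x xs)
    have "sorted_wrt ?R (map ((#) x) (product_lists xss))"
      using IH by (simp add: sorted_wrt_map)
    with Cons show ?case by (auto simp: sorted_wrt_append)
  qed
  then show ?case by simp
qed

lemma columns_sorted:
  "sorted_wrt (\<lambda>a b. (a, b) \<in> lexord {(x, y). x < y}) (columns I :: 'k::len word list list)"
  unfolding columns_def
  by (rule sorted_product_lists)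
     (auto simp: column_factors_def multiples_list_def strict_sorted_list_of_set)

lemma set_columns:
  "set (columns I) =
     {c. list_all2 (\<lambda>x F. x \<in> set F) c (column_factors I :: 'k::len word list list)}"
  unfolding columns_def by (auto simp: product_lists_set)

lemma set_multiples_list:
  "set (multiples_list j :: 'k::len word list) = {2 ^ (LENGTH('k) - j) * x | x. True}"
  by (auto simp: multiples_list_def image_def)

end

theory Submission
  imports Defs "HOL-Library.Function_Algebras"
begin

text \<open>
  Let \<open>M\<close> be the quotient of \<open>Z_(2^k)^n\<close> by the code \<open>H\<close>, and let \<open>g_i\<close> be the class of the \<open>i\<close>-th unit
  vector.  Perfectness says that every odd element of \<open>M\<close> is \<open>u g_i\<close> for exactly one index \<open>i\<close> and
  one odd \<open>u\<close>; in particular every odd element has order \<open>2^k\<close>.  Hence the parity character vanishes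
  on the elements killed by \<open>2^(k-1)\<close>, and, as \<open>Z_(2^k)\<close> is self-injective, it lifts to a linear
  form \<open>f\<close> on \<open>M\<close>.  Each odd orbit under units contains exactly one element with \<open>f = 1\<close>, so suitable
  unit multiples of the \<open>g_i\<close> enumerate the fibre \<open>f = 1\<close>, a coset of \<open>ker f\<close>.  Decomposing \<open>ker f\<close>
  into cyclic groups of order \<open>2^j\<close>, each embedded as \<open>2^(k-j) Z_(2^k)\<close>, turns this fibre into the set
  of columns of \<open>B_I\<close>, where \<open>I j\<close> counts the summands of order \<open>2^j\<close>.
\<close>

section \<open>Powers of two and units in \<open>Z_(2^k)\<close>\<close>

lemma word_eq_power_times_odd:
  fixes c :: "'k::len word"
  obtains s u where "s \<le> LENGTH('k)" "odd u" "c = 2 ^ s * u"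
proof (cases "c = 0")
  case True
  with that[of "LENGTH('k)" 1] show ?thesis by simp
next
  case False
  define m where "m = unat c"
  have m0: "m \<noteq> 0" using False by (simp add: m_def unat_eq_zero)
  then obtain q where q: "m = 2 ^ multiplicity 2 m * q" "\<not> 2 dvd q"
    using multiplicity_decompose'[of m 2] by auto
  have "2 ^ multiplicity 2 m \<le> m" using q m0 by (metis dvd_imp_le dvd_triv_left neq0_conv)
  also have "m < 2 ^ LENGTH('k)" by (simp add: m_def)
  finally have s: "multiplicity 2 m < LENGTH('k)" by simp
  have c: "c = of_nat m" by (simp add: m_def)
  have "c = 2 ^ multiplicity 2 m * of_nat q" by (subst c, subst q(1)) simp
  moreover have "odd (of_nat q :: 'k word)" using q(2) by simp
  ultimately show ?thesis using s that less_imp_le by metis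
qed

text \<open>An odd residue is coprime to \<open>2^k\<close>; its Bezout coefficient, read modulo
  \<open>2^k\<close>, is the inverse.\<close>

lemma odd_word_inverse:
  fixes u :: "'k::len word"
  assumes "odd u"
  obtains v where "u * v = 1"
proof -
  have "odd (of_int (uint u) :: 'k word)" using assms by simp
  then have "odd (uint u)" by (metis even_of_int_iff)
  then have "gcd (uint u) (2 ^ LENGTH('k)) = 1"
    by (simp add: coprime_commute flip: coprime_iff_gcd_eq_1)
  then obtain x y where "x * uint u + y * 2 ^ LENGTH('k) = 1"
    by (metis bezout_int)
  then have "(of_int (x * uint u + y * 2 ^ LENGTH('k)) :: 'k word) = 1" by simp
  then have "of_int x * u = 1" by (simp only: of_int_add of_int_mult of_int_power) simp
  then show ?thesis using that by (metis mult.commute)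
qed

text \<open>With \<open>b\<close> written as \<open>2^s\<close> times a unit, the product vanishes
  only if \<open>a + s \<ge> k\<close>. This is the arithmetic behind the self-injectivity of
  \<open>Z_(2^k)\<close>.\<close>

lemma pow2_dvd_annihilated:
  fixes b :: "'k::len word"
  assumes "2 ^ a * b = 0"
  shows "2 ^ (LENGTH('k) - a) dvd b"
proof -
  obtain s u where u: "s \<le> LENGTH('k)" "odd u" "b = 2 ^ s * u" by (rule word_eq_power_times_odd)
  obtain v where v: "u * v = 1" using odd_word_inverse[OF u(2)] by blast
  have "2 ^ (a + s) * (u * v) = 0" using assms u by (simp add: power_add flip: mult.assoc)
  then have "LENGTH('k) \<le> a + s" using v by simp
  then show ?thesis unfolding u(3) by (simp add: le_imp_power_dvd)
qed

subsection \<open>Linear forms on modules over \<open>Z_(2^k)\<close>\<close>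

locale word_module = module scale
  for scale :: "'k::len word \<Rightarrow> 'b::ab_group_add \<Rightarrow> 'b" (infixr \<open>*s\<close> 75)
begin

definition linear_form :: "('b \<Rightarrow> 'k word) \<Rightarrow> bool" where
  "linear_form f \<longleftrightarrow> (\<forall>x y. f (x + y) = f x + f y) \<and> (\<forall>c x. f (c *s x) = c * f x)"

lemma linear_form_add: "linear_form f \<Longrightarrow> f (x + y) = f x + f y"
  and linear_form_scale: "linear_form f \<Longrightarrow> f (c *s x) = c * f x"
  by (auto simp: linear_form_def)

lemma linear_form_zero: "linear_form f \<Longrightarrow> f 0 = 0"
  using linear_form_add[of f 0 0] by simp

lemma linear_form_diff: "linear_form f \<Longrightarrow> f (x - y) = f x - f y"
  using linear_form_add[of f "x - y" y] by simp

lemma linear_form_sum: "linear_form f \<Longrightarrow> f (\<Sum>i\<in>A. g i) = (\<Sum>i\<in>A. f (g i))"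
  by (induction A rule: infinite_finite_induct) (auto simp: linear_form_zero linear_form_add)

lemmas linear_form_simps =
  linear_form_add linear_form_scale linear_form_zero linear_form_diff linear_form_sum

lemma subspace_kernel_Int: "linear_form f \<Longrightarrow> subspace N \<Longrightarrow> subspace (N \<inter> {x. f x = 0})"
  by (auto simp: subspace_def linear_form_simps)

text \<open>A linear form on a submodule, encoded by its graph: extension becomes inclusion, which
  suits Zorn's lemma. By linearity, single-valuedness has to be demanded only at 0.\<close>

definition linear_graph :: "('b \<times> 'k word) set \<Rightarrow> bool" where
  "linear_graph G \<longleftrightarrow> (0, 0) \<in> G
     \<and> (\<forall>x y x' y'. (x, y) \<in> G \<longrightarrow> (x', y') \<in> G \<longrightarrow> (x + x', y + y') \<in> G)
     \<and> (\<forall>c x y. (x, y) \<in> G \<longrightarrow> (c *s x, c * y) \<in> G)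
     \<and> (\<forall>y. (0, y) \<in> G \<longrightarrow> y = 0)"

lemma linear_graphD:
  assumes "linear_graph G"
  shows "(0, 0) \<in> G"
    and "(x, y) \<in> G \<Longrightarrow> (x', y') \<in> G \<Longrightarrow> (x + x', y + y') \<in> G"
    and "(x, y) \<in> G \<Longrightarrow> (c *s x, c * y) \<in> G"
    and "(0, y) \<in> G \<Longrightarrow> y = 0"
  using assms by (auto simp: linear_graph_def)

lemma linear_graph_unique:
  assumes G: "linear_graph G" and "(x, y) \<in> G" "(x, y') \<in> G"
  shows "y = y'"
proof -
  have "(x + (- 1) *s x, y + (- 1) * y') \<in> G"
    using assms by (intro linear_graphD(2)[OF G] linear_graphD(3)[OF G])
  then have "(0, y - y') \<in> G" by simp
  then show ?thesis using linear_graphD(4)[OF G] by fastforce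
qed

text \<open>The \<open>c\<close> for which \<open>c *s v\<close> lies in the domain form an ideal
  generated by some \<open>2^m\<close>. The value at \<open>2^m *s v\<close> is divisible by
  \<open>2^m\<close>, and a quotient \<open>b\<close> can serve as the value at
  \<open>v\<close>.\<close>

lemma linear_graph_extend:
  assumes G: "linear_graph G"
  shows "\<exists>b. linear_graph {(x + c *s v, y + c * b) | x y c. (x, y) \<in> G}"
proof -
  define m where "m = (LEAST m. \<exists>y. ((2 ^ m) *s v, y) \<in> G)"
  have "((2 ^ LENGTH('k)) *s v, 0) \<in> G" using linear_graphD(1)[OF G] by simp
  then have "\<exists>m y. ((2 ^ m) *s v, y) \<in> G" by blast
  then have "\<exists>y. ((2 ^ m) *s v, y) \<in> G" unfolding m_def by (rule LeastI_ex)
  then obtain y0 where y0: "((2 ^ m) *s v, y0) \<in> G" by blast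
  \<comment> \<open>Multiplying by the inverse of the odd part of \<open>c\<close> brings a pure
    power of two into the ideal, and the minimality of \<open>m\<close> applies to it.\<close>
  have dvd: "2 ^ m dvd c" if cG: "(c *s v, y) \<in> G" for c y
  proof -
    obtain s u where u: "odd u" "c = 2 ^ s * u" by (rule word_eq_power_times_odd)
    obtain w where w: "u * w = 1" using odd_word_inverse[OF u(1)] by blast
    have "(w *s (c *s v), w * y) \<in> G" using cG by (rule linear_graphD(3)[OF G])
    moreover have "w * c = (u * w) * 2 ^ s" unfolding u(2) by (simp only: ac_simps)
    ultimately have "((2 ^ s) *s v, w * y) \<in> G" by (simp add: w)
    then have "m \<le> s" unfolding m_def by (intro Least_le) blast
    then show ?thesis using u(2) by (simp add: le_imp_power_dvd)
  qed
  have "m \<le> LENGTH('k)"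
    unfolding m_def using linear_graphD(1)[OF G] by (intro Least_le) auto
  then have e: "(2::'k word) ^ (LENGTH('k) - m) * 2 ^ m = 0" by (simp flip: power_add)
  \<comment> \<open>This pair lies over 0, so \<open>2^(k-m)\<close> annihilates \<open>y0\<close>;
    hence \<open>2^m\<close> divides \<open>y0\<close>.\<close>
  have "((2 ^ (LENGTH('k) - m)) *s (2 ^ m) *s v, 2 ^ (LENGTH('k) - m) * y0) \<in> G"
    using y0 by (rule linear_graphD(3)[OF G])
  then have "2 ^ (LENGTH('k) - m) * y0 = 0" using e linear_graphD(4)[OF G] by simp
  then have "2 ^ m dvd y0" using pow2_dvd_annihilated \<open>m \<le> LENGTH('k)\<close>
    by (metis diff_diff_cancel)
  then obtain b where b: "y0 = 2 ^ m * b" by (auto simp: dvd_def)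
  \<comment> \<open>The choice of \<open>b\<close> agrees with \<open>G\<close> on every multiple of
    \<open>v\<close> in the domain, which keeps the enlarged graph single-valued.\<close>
  have *: "y = c * b" if cG: "(c *s v, y) \<in> G" for c y
  proof -
    obtain d where d: "c = 2 ^ m * d" using dvd[OF cG] by (auto simp: dvd_def)
    have "(d *s (2 ^ m) *s v, d * y0) \<in> G" using y0 by (rule linear_graphD(3)[OF G])
    then have "(c *s v, d * y0) \<in> G" by (simp add: d ac_simps)
    with cG have "y = d * y0" by (rule linear_graph_unique[OF G])
    then show ?thesis by (simp add: b d)
  qed
  have "linear_graph {(x + c *s v, y + c * b) | x y c. (x, y) \<in> G}" (is "linear_graph ?G'")
    unfolding linear_graph_def
  proof (intro conjI allI impI)
    have "(0 + 0 *s v, 0 + 0 * b) \<in> ?G'" using linear_graphD(1)[OF G] by blast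
    then show "(0, 0) \<in> ?G'" by simp
  next
    fix x y x' y' assume "(x, y) \<in> ?G'" "(x', y') \<in> ?G'"
    then obtain p q c p' q' c' where 1: "(p, q) \<in> G" "(p', q') \<in> G"
      "x = p + c *s v" "y = q + c * b" "x' = p' + c' *s v" "y' = q' + c' * b" by blast
    have "((p + p') + (c + c') *s v, (q + q') + (c + c') * b) \<in> ?G'"
      using linear_graphD(2)[OF G 1(1,2)] by blast
    then show "(x + x', y + y') \<in> ?G'" by (simp add: 1 algebra_simps)
  next
    fix d x y assume "(x, y) \<in> ?G'"
    then obtain p q c where 1: "(p, q) \<in> G" "x = p + c *s v" "y = q + c * b" by blast
    have "(d *s p + (d * c) *s v, d * q + (d * c) * b) \<in> ?G'"
      using linear_graphD(3)[OF G 1(1)] by blast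
    then show "(d *s x, d * y) \<in> ?G'" by (simp add: 1 algebra_simps)
  next
    fix y assume "(0, y) \<in> ?G'"
    then obtain p q c where 1: "(p, q) \<in> G" "0 = p + c *s v" "y = q + c * b" by blast
    have "((- 1) *s p, (- 1) * q) \<in> G" using 1(1) by (rule linear_graphD(3)[OF G])
    moreover have "(- 1) *s p = c *s v" using 1(2) by (simp add: eq_neg_iff_add_eq_0 neg_eq_iff_add_eq_0)
    ultimately have "(c *s v, - q) \<in> G" by simp
    then show "y = 0" using * 1(3) by fastforce
  qed
  then show ?thesis ..
qed

text \<open>Baer's criterion for \<open>Z / 2^k\<close>, which is self-injective.\<close>

lemma linear_graph_imp_linear_form:
  assumes "linear_graph G"
  obtains f where "linear_form f" "\<And>x y. (x, y) \<in> G \<Longrightarrow> f x = y"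
proof -
  have "\<exists>M\<in>{M. linear_graph M \<and> G \<subseteq> M}. \<forall>X\<in>{M. linear_graph M \<and> G \<subseteq> M}. M \<subseteq> X \<longrightarrow> X = M"
  proof (rule subset_Zorn_nonempty)
    show "{M. linear_graph M \<and> G \<subseteq> M} \<noteq> {}" using assms by blast
  next
    fix C assume ne: "C \<noteq> {}" and ch: "subset.chain {M. linear_graph M \<and> G \<subseteq> M} C"
    have lg: "linear_graph M" "G \<subseteq> M" if "M \<in> C" for M
      using ch that by (auto simp: subset_chain_def)
    have "linear_graph (\<Union>C)"
      unfolding linear_graph_def
    proof (intro conjI allI impI)
      show "(0, 0) \<in> \<Union>C" using ne lg linear_graphD(1) by blast
    next
      fix x y x' y' assume "(x, y) \<in> \<Union>C" "(x', y') \<in> \<Union>C"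
      then obtain M M' where M: "M \<in> C" "M' \<in> C" "(x, y) \<in> M" "(x', y') \<in> M'" by blast
      have "M \<subseteq> M' \<or> M' \<subseteq> M" using ch M(1,2) by (auto simp: subset_chain_def)
      then show "(x + x', y + y') \<in> \<Union>C"
      proof
        assume "M \<subseteq> M'"
        then have "(x + x', y + y') \<in> M'" using M lg linear_graphD(2) by blast
        then show ?thesis using M by blast
      next
        assume "M' \<subseteq> M"
        then have "(x + x', y + y') \<in> M" using M lg linear_graphD(2) by blast
        then show ?thesis using M by blast
      qed
    next
      fix c x y assume "(x, y) \<in> \<Union>C"
      then show "(c *s x, c * y) \<in> \<Union>C" using lg linear_graphD(3) by blast
    next
      fix y assume "(0, y) \<in> \<Union>C"
      then show "y = 0" using lg linear_graphD(4) by blast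
    qed
    then show "\<Union>C \<in> {M. linear_graph M \<and> G \<subseteq> M}" using ne lg by blast
  qed
  then obtain M where "M \<in> {M. linear_graph M \<and> G \<subseteq> M}"
    and max': "\<forall>X\<in>{M. linear_graph M \<and> G \<subseteq> M}. M \<subseteq> X \<longrightarrow> X = M" by (rule bexE)
  then have M: "linear_graph M" "G \<subseteq> M" by simp_all
  have max: "X = M" if "linear_graph X" "M \<subseteq> X" for X using max' that M(2) by auto
  \<comment> \<open>A maximal graph has full domain, since its extension by \<open>v\<close> cannot
    be strictly larger.\<close>
  have total: "\<exists>y. (v, y) \<in> M" for v
  proof -
    obtain b where b: "linear_graph {(x + c *s v, y + c * b) | x y c. (x, y) \<in> M}" (is "linear_graph ?M'")
      using linear_graph_extend[OF M(1)] by blast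
    have "(x + 0 *s v, y + 0 * b) \<in> ?M'" if "(x, y) \<in> M" for x y using that by blast
    then have sub: "M \<subseteq> ?M'" by auto
    have "(0 + 1 *s v, 0 + 1 * b) \<in> ?M'" using linear_graphD(1)[OF M(1)] by blast
    then have "(v, b) \<in> ?M'" by simp
    then have "(v, b) \<in> M" unfolding max[OF b sub] .
    then show ?thesis ..
  qed
  define f where "f v = (THE y. (v, y) \<in> M)" for v
  have fM: "f v = y \<longleftrightarrow> (v, y) \<in> M" for v y
    unfolding f_def using total linear_graph_unique[OF M(1)] by (metis the_equality)
  show ?thesis
  proof
    show "linear_form f"
      unfolding linear_form_def fM using linear_graphD(2,3)[OF M(1)] fM by blast
    show "f x = y" if "(x, y) \<in> G" for x y using that M(2) fM by blast
  qed
qed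

section \<open>Splitting a finite module into cyclic summands\<close>

text \<open>The forms in \<open>ws\<close> identify \<open>N / H\<close> with the product of the ideals \<open>2^(k - j) Z_(2^k)\<close>,
  each cyclic of order \<open>2^j\<close>, for \<open>j\<close> in \<open>js\<close>.\<close>

definition coordinate_system :: "'b set \<Rightarrow> 'b set \<Rightarrow> ('b \<Rightarrow> 'k word) list \<Rightarrow> nat list \<Rightarrow> bool" where
  "coordinate_system H N ws js \<longleftrightarrow>
     (\<forall>w\<in>set ws. linear_form w)
   \<and> (\<forall>x\<in>N. x \<in> H \<longleftrightarrow> (\<forall>w\<in>set ws. w x = 0))
   \<and> (\<forall>x\<in>N. list_all2 (\<lambda>w j. 2 ^ (LENGTH('k) - j) dvd w x) ws js)
   \<and> (\<forall>ys. list_all2 (\<lambda>y j. 2 ^ (LENGTH('k) - j) dvd y) ys js \<longrightarrow> (\<exists>x\<in>N. map (\<lambda>w. w x) ws = ys))"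

lemma coordinate_system_surj:
  assumes "coordinate_system H N ws js" "list_all2 (\<lambda>y j. 2 ^ (LENGTH('k) - j) dvd y) ys js"
  obtains x where "x \<in> N" "map (\<lambda>w. w x) ws = ys"
proof -
  have "\<exists>x\<in>N. map (\<lambda>w. w x) ws = ys"
    using assms unfolding coordinate_system_def by simp
  then show ?thesis by (rule bexE) (rule that)
qed

text \<open>The summand of largest order is split off first and sits at the head; moving it to the
  end leaves the orders increasing.\<close>

lemma coordinate_system_rotate1:
  assumes "coordinate_system H N (w # ws) (j # js)"
  shows "coordinate_system H N (ws @ [w]) (js @ [j])"
  unfolding coordinate_system_def
proof (intro conjI allI impI)
  have len: "length ws = length js" if "x \<in> N" for x
    using assms that unfolding coordinate_system_def by (auto dest: list_all2_lengthD)
  show "\<forall>w\<in>set (ws @ [w]). linear_form w"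
    and "\<forall>x\<in>N. x \<in> H \<longleftrightarrow> (\<forall>w\<in>set (ws @ [w]). w x = 0)"
    and "\<forall>x\<in>N. list_all2 (\<lambda>w j. 2 ^ (LENGTH('k) - j) dvd w x) (ws @ [w]) (js @ [j])"
    using assms len by (auto simp: coordinate_system_def list_all2_append)
  fix ys :: "'k word list"
  assume "list_all2 (\<lambda>y j. 2 ^ (LENGTH('k) - j) dvd y) ys (js @ [j])"
  then obtain ys' y where y: "ys = ys' @ [y]"
    "list_all2 (\<lambda>y j. 2 ^ (LENGTH('k) - j) dvd y) ys' js" "2 ^ (LENGTH('k) - j) dvd y"
    by (auto simp: list_all2_append2 list_all2_Cons2)
  then have "list_all2 (\<lambda>y j. 2 ^ (LENGTH('k) - j) dvd y) (y # ys') (j # js)" by simp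
  with assms obtain x where "x \<in> N" "map (\<lambda>w. w x) (w # ws) = y # ys'"
    by (rule coordinate_system_surj)
  then show "\<exists>x\<in>N. map (\<lambda>w. w x) (ws @ [w]) = ys" using y by auto
qed

text \<open>The value \<open>w x\<close> at \<open>x + c *s g\<close> is well defined: if this sum
  is 0, then \<open>x\<close> is a multiple of \<open>g\<close> in \<open>N\<close>, hence lies in
  \<open>H\<close>, where \<open>w\<close> vanishes. The resulting partial form then extends to the
  whole module.\<close>

lemma linear_form_annihilating:
  assumes N: "subspace N" and w: "linear_form w" "\<And>x. x \<in> N \<Longrightarrow> x \<in> H \<Longrightarrow> w x = 0"
    and g: "\<And>c. c *s g \<in> N \<Longrightarrow> c *s g \<in> H"
  obtains w' where "linear_form w'" "w' g = 0" "\<And>x. x \<in> N \<Longrightarrow> w' x = w x"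
proof -
  have "linear_graph {(x + c *s g, w x) | x c. x \<in> N}" (is "linear_graph ?G")
    unfolding linear_graph_def
  proof (intro conjI allI impI)
    have "(0 + 0 *s g, w 0) \<in> ?G" using subspace_0[OF N] by blast
    then show "(0, 0) \<in> ?G" by (simp add: linear_form_zero[OF w(1)])
  next
    fix x y x' y' assume "(x, y) \<in> ?G" "(x', y') \<in> ?G"
    then obtain p c p' c' where 1: "p \<in> N" "p' \<in> N"
      "x = p + c *s g" "y = w p" "x' = p' + c' *s g" "y' = w p'" by blast
    have "((p + p') + (c + c') *s g, w (p + p')) \<in> ?G" using subspace_add[OF N 1(1,2)] by blast
    then show "(x + x', y + y') \<in> ?G" by (simp add: 1 algebra_simps linear_form_add[OF w(1)])
  next
    fix d x y assume "(x, y) \<in> ?G"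
    then obtain p c where 1: "p \<in> N" "x = p + c *s g" "y = w p" by blast
    have "(d *s p + (d * c) *s g, w (d *s p)) \<in> ?G" using subspace_scale[OF N 1(1)] by blast
    then show "(d *s x, d * y) \<in> ?G" by (simp add: 1 algebra_simps linear_form_scale[OF w(1)])
  next
    fix y assume "(0, y) \<in> ?G"
    then obtain p c where 1: "p \<in> N" "0 = p + c *s g" "y = w p" by blast
    have eq: "(- c) *s g = p" using 1(2) by (simp add: neg_eq_iff_add_eq_0 add.commute)
    then have "p \<in> H" using g 1(1) by metis
    then show "y = 0" using w(2) 1 by simp
  qed
  then obtain f where f: "linear_form f" "\<And>x y. (x, y) \<in> ?G \<Longrightarrow> f x = y"
    by (rule linear_graph_imp_linear_form) blast
  show ?thesis
  proof
    have "(0 + 1 *s g, w 0) \<in> ?G" using subspace_0[OF N] by blast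
    then show "f g = 0" using f(2) by (simp add: linear_form_zero[OF w(1)])
    fix x assume "x \<in> N"
    then have "(x + 0 *s g, w x) \<in> ?G" by blast
    then show "f x = w x" using f(2) by simp
  qed (rule f(1))
qed

text \<open>Modulo \<open>H\<close>, the module \<open>N\<close> is the direct sum of the multiples
  of \<open>g\<close> and the kernel of \<open>w\<close>. The coordinates on the kernel are replaced
  by forms vanishing at \<open>g\<close>, so that they read off the kernel component of every
  element.\<close>

lemma coordinate_system_Cons:
  assumes N: "subspace N" and "subspace H" and w: "linear_form w" "\<And>x. x \<in> H \<Longrightarrow> w x = 0"
    and dvd: "\<And>x. x \<in> N \<Longrightarrow> 2 ^ (LENGTH('k) - j) dvd w x"
    and g: "g \<in> N" "w g = 2 ^ (LENGTH('k) - j)" "(2 ^ j) *s g \<in> H" and j: "j \<le> LENGTH('k)"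
    and cs: "coordinate_system H (N \<inter> {x. w x = 0}) ws js"
  obtains ws' where "coordinate_system H N (w # ws') (j # js)"
proof -
  let ?N = "N \<inter> {x. w x = 0}"
  have sN: "subspace ?N" using w(1) N by (rule subspace_kernel_Int)
  \<comment> \<open>The sum is direct modulo \<open>H\<close>: if \<open>w\<close> kills
    \<open>c *s g\<close>, then \<open>2^j\<close> divides \<open>c\<close>.\<close>
  have gH: "c *s g \<in> H" if "c *s g \<in> ?N" for c
  proof -
    have "2 ^ (LENGTH('k) - j) * c = 0" using that by (simp add: linear_form_scale[OF w(1)] g mult.commute)
    then have "2 ^ j dvd c" using pow2_dvd_annihilated[of "LENGTH('k) - j" c] j by simp
    then obtain d where "c = 2 ^ j * d" by (auto simp: dvd_def)
    then have "c *s g = d *s (2 ^ j) *s g" by (simp add: mult.commute)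
    then show ?thesis using subspace_scale[OF \<open>subspace H\<close> g(3)] by simp
  qed
  have ws: "linear_form v" "x \<in> ?N \<Longrightarrow> x \<in> H \<Longrightarrow> v x = 0" if "v \<in> set ws" for v x
    using cs that by (auto simp: coordinate_system_def)
  have "\<exists>v'. linear_form v' \<and> v' g = 0 \<and> (\<forall>x\<in>?N. v' x = v x)" if v: "v \<in> set ws" for v
  proof -
    obtain v' where "linear_form v'" "v' g = 0" "\<And>x. x \<in> ?N \<Longrightarrow> v' x = v x"
      by (rule linear_form_annihilating[OF sN ws(1)[OF v], of H g]) (simp_all add: ws(2)[OF v] gH)
    then show ?thesis by blast
  qed
  then have "\<exists>F. \<forall>v\<in>set ws. linear_form (F v) \<and> F v g = 0 \<and> (\<forall>x\<in>?N. F v x = v x)"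
    by (intro bchoice ballI)
  then obtain F where F: "\<forall>v\<in>set ws. linear_form (F v) \<and> F v g = 0 \<and> (\<forall>x\<in>?N. F v x = v x)"
    by (elim exE) (rule that)
  \<comment> \<open>The multiple of \<open>g\<close> to subtract is found by dividing
    \<open>w x\<close> by \<open>w g\<close>.\<close>
  have dec: "\<exists>c x'. x = x' + c *s g \<and> w x = c * 2 ^ (LENGTH('k) - j) \<and> x' \<in> ?N" if x: "x \<in> N" for x
  proof -
    obtain c where c: "w x = 2 ^ (LENGTH('k) - j) * c" using dvd[OF x] by (auto simp: dvd_def)
    have "x - c *s g \<in> ?N"
      using x g(1) N c by (auto simp: subspace_diff subspace_scale linear_form_simps[OF w(1)] g(2))
    then show ?thesis using c by (intro exI[of _ c] exI[of _ "x - c *s g"]) (simp add: mult.commute)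
  qed
  have "coordinate_system H N (w # map F ws) (j # js)"
    unfolding coordinate_system_def
  proof (intro conjI allI impI ballI)
    fix v assume "v \<in> set (w # map F ws)"
    then show "linear_form v" using w(1) F by auto
  next
    fix x assume x: "x \<in> N"
    have "x \<in> H \<longleftrightarrow> (w x = 0 \<and> (\<forall>v\<in>set ws. F v x = 0))"
    proof (cases "w x = 0")
      case True
      then show ?thesis using x F cs by (simp add: coordinate_system_def)
    qed (use w(2) in auto)
    then show "x \<in> H \<longleftrightarrow> (\<forall>v\<in>set (w # map F ws). v x = 0)" by simp
    obtain c x' where c: "x = x' + c *s g" "x' \<in> ?N" using dec[OF x] by blast
    have Fx: "F v x = v x'" if "v \<in> set ws" for v
      using that c F by (simp add: linear_form_simps)
    have "list_all2 (\<lambda>w j. 2 ^ (LENGTH('k) - j) dvd w x') ws js"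
      using cs c(2) by (auto simp: coordinate_system_def)
    then have "list_all2 (\<lambda>w j. 2 ^ (LENGTH('k) - j) dvd F w x) ws js"
      by (rule list.rel_mono_strong) (simp add: Fx)
    then show "list_all2 (\<lambda>w j. 2 ^ (LENGTH('k) - j) dvd w x) (w # map F ws) (j # js)"
      using dvd[OF x] by (simp add: list_all2_map1)
  next
    fix ys :: "'k word list"
    assume "list_all2 (\<lambda>y j. 2 ^ (LENGTH('k) - j) dvd y) ys (j # js)"
    then obtain c ys' where y: "ys = (2 ^ (LENGTH('k) - j) * c) # ys'"
      "list_all2 (\<lambda>y j. 2 ^ (LENGTH('k) - j) dvd y) ys' js"
      by (auto simp: list_all2_Cons2 dvd_def)
    obtain x' where x': "x' \<in> ?N" "map (\<lambda>w. w x') ws = ys'"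
      using cs y(2) by (rule coordinate_system_surj)
    have "map (\<lambda>v. F v (x' + c *s g)) ws = ys'"
      unfolding x'(2)[symmetric] using x'(1) F by (intro map_cong) (simp_all add: linear_form_simps)
    then have "map (\<lambda>w. w (x' + c *s g)) (w # map F ws) = ys"
      using x' y by (simp add: linear_form_simps[OF w(1)] g(2) mult.commute o_def)
    moreover have "x' + c *s g \<in> N"
      using x'(1) subspace_add[OF N _ subspace_scale[OF N g(1)]] by blast
    ultimately show "\<exists>x\<in>N. map (\<lambda>w. w x) (w # map F ws) = ys" by blast
  qed
  then show ?thesis by (rule that)
qed

text \<open>Induction on the number of cosets of \<open>H\<close> in \<open>N\<close>. An element of
  maximal order \<open>2^j\<close> modulo \<open>H\<close> generates a direct summand: the form
  sending it to \<open>2^(k-j)\<close> extends by self-injectivity, and the kernel is a complement.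
  The bound \<open>J\<close> passed to the kernel is \<open>j\<close>, which makes the list of
  orders increasing.\<close>

lemma coordinate_system_exists:
  assumes "subspace H" "subspace N" "H \<subseteq> N" "finite ((\<lambda>x. {y. y - x \<in> H}) ` N)"
    and "J \<le> LENGTH('k)" "\<And>x. x \<in> N \<Longrightarrow> (2 ^ J) *s x \<in> H"
  obtains ws js where "coordinate_system H N ws js" "sorted js" "set js \<subseteq> {1..J}"
  using assms(2-)
proof (induction "card ((\<lambda>x. {y. y - x \<in> H}) ` N)" arbitrary: N J thesis rule: less_induct)
  case (less N J)
  \<comment> \<open>\<open>2^j\<close> is the exponent of \<open>N / H\<close>.\<close>
  define j where "j = (LEAST j. \<forall>x\<in>N. (2 ^ j) *s x \<in> H)"
  have jN: "\<forall>x\<in>N. (2 ^ j) *s x \<in> H"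
    unfolding j_def by (rule LeastI[where P = "\<lambda>j. \<forall>x\<in>N. (2 ^ j) *s x \<in> H"]) (use less.prems in blast)
  have jJ: "j \<le> J" unfolding j_def using less.prems by (intro Least_le) blast
  show ?case
  proof (cases "j = 0")
    case True
    then have "N = H" using jN less.prems by auto
    then have "coordinate_system H N [] []"
      using subspace_0[OF assms(1)] by (auto simp: coordinate_system_def)
    then show ?thesis using less.prems(1) by force
  next
    case False
    then have "\<not> (\<forall>x\<in>N. (2 ^ (j - 1)) *s x \<in> H)"
      unfolding j_def by (intro not_less_Least) (simp flip: j_def)
    then obtain g where g: "g \<in> N" "(2 ^ (j - 1)) *s g \<notin> H" by blast
    have jk: "j \<le> LENGTH('k)" using jJ less.prems by simp
    \<comment> \<open>The order of \<open>g\<close> modulo \<open>H\<close> is exactly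
      \<open>2^j\<close>, so the annihilator of its class consists of the multiples of
      \<open>2^j\<close>.\<close>
    have cd: "2 ^ j dvd c" if c: "c *s g \<in> H" for c
    proof -
      obtain s u where u: "odd u" "c = 2 ^ s * u" by (rule word_eq_power_times_odd)
      obtain v where v: "u * v = 1" using odd_word_inverse[OF u(1)] by blast
      have "j \<le> s"
      proof (rule ccontr)
        assume "\<not> j \<le> s"
        then have "j - 1 = s + (j - 1 - s)" by simp
        then obtain t where t: "j - 1 = s + t" by blast
        have "2 ^ t * v * c = (u * v) * 2 ^ (j - 1)"
          unfolding u(2) t power_add by (simp only: ac_simps)
        then have "(2 ^ (j - 1)) *s g = (2 ^ t * v) *s c *s g" by (simp add: v)
        then show False using g(2) subspace_scale[OF assms(1) c] by simp
      qed
      then show ?thesis using u(2) by (simp add: le_imp_power_dvd)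
    qed
    \<comment> \<open>The form on \<open>H\<close> plus the multiples of \<open>g\<close> that kills
      \<open>H\<close> and sends \<open>g\<close> to \<open>2^(k-j)\<close>; it is well defined by
      \<open>cd\<close>.\<close>
    have "linear_graph {(h + c *s g, c * 2 ^ (LENGTH('k) - j)) | h c. h \<in> H}" (is "linear_graph ?G")
      unfolding linear_graph_def
    proof (intro conjI allI impI)
      have "(0 + 0 *s g, 0 * 2 ^ (LENGTH('k) - j)) \<in> ?G" using subspace_0[OF assms(1)] by blast
      then show "(0, 0) \<in> ?G" by simp
    next
      fix x y x' y' assume "(x, y) \<in> ?G" "(x', y') \<in> ?G"
      then obtain p c p' c' where 1: "p \<in> H" "p' \<in> H"
        "x = p + c *s g" "y = c * 2 ^ (LENGTH('k) - j)"
        "x' = p' + c' *s g" "y' = c' * 2 ^ (LENGTH('k) - j)" by blast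
      have "((p + p') + (c + c') *s g, (c + c') * 2 ^ (LENGTH('k) - j)) \<in> ?G"
        using subspace_add[OF assms(1) 1(1,2)] by blast
      then show "(x + x', y + y') \<in> ?G" by (simp add: 1 algebra_simps)
    next
      fix d x y assume "(x, y) \<in> ?G"
      then obtain p c where 1: "p \<in> H" "x = p + c *s g" "y = c * 2 ^ (LENGTH('k) - j)" by blast
      have "(d *s p + (d * c) *s g, (d * c) * 2 ^ (LENGTH('k) - j)) \<in> ?G"
        using subspace_scale[OF assms(1) 1(1)] by blast
      then show "(d *s x, d * y) \<in> ?G" by (simp add: 1 algebra_simps)
    next
      fix y assume "(0, y) \<in> ?G"
      then obtain p c where 1: "p \<in> H" "0 = p + c *s g" "y = c * 2 ^ (LENGTH('k) - j)" by blast
      have "c *s g = - p" using 1(2) by (simp add: eq_neg_iff_add_eq_0 add.commute)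
      then have "2 ^ j dvd c" using cd 1(1) subspace_neg[OF assms(1)] by metis
      then obtain d where d: "c = 2 ^ j * d" by (auto simp: dvd_def)
      have "y = d * 2 ^ (j + (LENGTH('k) - j))" by (simp add: 1 d power_add ac_simps)
      then show "y = 0" using jk by simp
    qed
    then obtain w where w: "linear_form w" "\<And>x y. (x, y) \<in> ?G \<Longrightarrow> w x = y"
      by (rule linear_graph_imp_linear_form) blast
    have "(0 + 1 *s g, 1 * 2 ^ (LENGTH('k) - j)) \<in> ?G" using subspace_0[OF assms(1)] by blast
    then have wg: "w g = 2 ^ (LENGTH('k) - j)" using w(2) by simp
    have wH: "w x = 0" if "x \<in> H" for x
    proof -
      have "(x + 0 *s g, 0 * 2 ^ (LENGTH('k) - j)) \<in> ?G" using that by blast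
      then show ?thesis using w(2) by simp
    qed
    \<comment> \<open>All of \<open>N\<close> is killed by \<open>2^j\<close> modulo
      \<open>H\<close>, which confines the values of \<open>w\<close> to the ideal of
      \<open>2^(k-j)\<close>.\<close>
    have wN: "2 ^ (LENGTH('k) - j) dvd w x" if "x \<in> N" for x
    proof -
      have "2 ^ j * w x = 0" using wH jN that by (metis linear_form_scale w(1))
      then show ?thesis by (rule pow2_dvd_annihilated)
    qed
    let ?N = "N \<inter> {x. w x = 0}"
    have sN: "subspace ?N" using w(1) less.prems by (intro subspace_kernel_Int)
    have HN: "H \<subseteq> ?N" using wH less.prems by blast
    have "LENGTH('k) - j < LENGTH('k)" using False by simp
    then have gN: "g \<notin> ?N" using wg by (simp flip: not_less)
    have "card ((\<lambda>x. {y. y - x \<in> H}) ` ?N) < card ((\<lambda>x. {y. y - x \<in> H}) ` N)"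
    proof (rule psubset_card_mono)
      \<comment> \<open>The coset of \<open>g\<close> is lost on passing to the kernel, because
        \<open>w g\<close> is nonzero and \<open>w\<close> is constant on cosets of
        \<open>H\<close>.\<close>
      have "{y. y - g \<in> H} \<notin> (\<lambda>x. {y. y - x \<in> H}) ` ?N"
      proof
        assume "{y. y - g \<in> H} \<in> (\<lambda>x. {y. y - x \<in> H}) ` ?N"
        then obtain x where x: "x \<in> ?N" "{y. y - g \<in> H} = {y. y - x \<in> H}" by blast
        have "g - g \<in> H" using subspace_0[OF assms(1)] by simp
        then have "g - x \<in> H" using x(2) by blast
        then have "g - x \<in> ?N" using HN by blast
        then have "x + (g - x) \<in> ?N" using x(1) sN subspace_add by blast
        then show False using gN by simp
      qed
      then show "(\<lambda>x. {y. y - x \<in> H}) ` ?N \<subset> (\<lambda>x. {y. y - x \<in> H}) ` N" using g(1) by blast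
    qed (rule less.prems)
    moreover have "finite ((\<lambda>x. {y. y - x \<in> H}) ` ?N)"
      using less.prems(4) by (rule rev_finite_subset) blast
    ultimately obtain ws js where ws: "coordinate_system H ?N ws js" "sorted js" "set js \<subseteq> {1..j}"
      using less.hyps[of ?N j] sN HN jN jk by blast
    obtain ws' where "coordinate_system H N (w # ws') (j # js)"
      using coordinate_system_Cons[OF less.prems(2) assms(1) w(1) wH wN g(1) wg _ jk ws(1)] jN g(1) by blast
    then have "coordinate_system H N (ws' @ [w]) (js @ [j])" by (rule coordinate_system_rotate1)
    moreover have "sorted (js @ [j])" "set (js @ [j]) \<subseteq> {1..J}"
      using ws jJ False by (auto simp: sorted_append)
    ultimately show ?thesis by (rule less.prems(1))
  qed
qed

end

subsection \<open>The quotient by a perfect code\<close>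

text \<open>Vectors of all dimensions together form no group, whereas functions on
  \<open>nat\<close> do under pointwise addition; words are therefore treated as functions of which
  only the first \<open>n\<close> values matter.\<close>

interpretation fn: word_module
  "(\<lambda>c x i. c * x i) :: 'k::len word \<Rightarrow> (nat \<Rightarrow> 'k word) \<Rightarrow> nat \<Rightarrow> 'k word"
  by unfold_locales (auto simp: fun_eq_iff algebra_simps)

definition single :: "nat \<Rightarrow> 'a::zero \<Rightarrow> nat \<Rightarrow> 'a" where
  "single i u = (\<lambda>j. if j = i then u else 0)"

lemma sum_single: "i < n \<Longrightarrow> (\<Sum>j<n. single i u j) = (u :: 'a::comm_monoid_add)"
  by (simp add: single_def)

lemma single_diff: "single i (u - v) = single i u - single i (v :: 'a::group_add)"
  by (auto simp: single_def fun_eq_iff)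

lemma mult_single: "(\<lambda>j. c * single i u j) = single i (c * (u :: 'a::mult_zero))"
  by (auto simp: single_def fun_eq_iff)

lemma linear_form_single: "fn.linear_form f \<Longrightarrow> f (single i (c * u)) = c * f (single i u)"
  using fn.linear_form_scale[of f c "single i u"] by (simp add: mult_single)

text \<open>A \<open>1'\<close>-perfect code, with its words extended arbitrarily beyond the coordinates \<open>i < n\<close>.\<close>

locale perfect_subspace =
  fixes n :: nat and H :: "(nat \<Rightarrow> 'k::len word) set"
  assumes subspace_H: "fn.subspace H"
    and zero_mem: "\<And>x. (\<And>i. i < n \<Longrightarrow> x i = 0) \<Longrightarrow> x \<in> H"
    and even_sum: "\<And>x. x \<in> H \<Longrightarrow> even (\<Sum>i<n. x i)"
    and cover: "\<And>x. odd (\<Sum>i<n. x i) \<Longrightarrow> \<exists>i<n. \<exists>u. odd u \<and> x - single i u \<in> H"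
    and unique: "\<And>i j u v. i < n \<Longrightarrow> j < n \<Longrightarrow> odd u \<Longrightarrow> odd v \<Longrightarrow>
      single i u - single j v \<in> H \<Longrightarrow> i = j \<and> u = v"
begin

text \<open>By \<open>cover\<close>, \<open>x\<close> may be replaced by a word
  \<open>single i u\<close> with \<open>u\<close> odd. If \<open>2^(k-1)\<close> killed it modulo
  \<open>H\<close>, then \<open>u\<close> and \<open>u + 2^(k-1) * u\<close> would be odd and give
  the same coset, against \<open>unique\<close>.\<close>

lemma odd_sum_full_order:
  assumes x: "odd (\<Sum>i<n. x i)"
  shows "(\<lambda>i. 2 ^ (LENGTH('k) - 1) * x i) \<notin> H"
proof
  let ?q = "2 ^ (LENGTH('k) - 1) :: 'k word"
  assume H: "(\<lambda>i. ?q * x i) \<in> H"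
  obtain i u where i: "i < n" "odd u" "x - single i u \<in> H" using cover[OF x] by blast
  have "(\<lambda>j. ?q * x j) - (\<lambda>j. ?q * (x - single i u) j) \<in> H"
    using H fn.subspace_scale[OF subspace_H i(3)] by (rule fn.subspace_diff[OF subspace_H])
  also have "(\<lambda>j. ?q * x j) - (\<lambda>j. ?q * (x - single i u) j) = single i (?q * u)"
    by (auto simp: fun_eq_iff single_def algebra_simps)
  finally have qu: "single i (?q * u) \<in> H" .
  \<comment> \<open>For k = 1 the factor \<open>?q\<close> is 1, so the evenness is drawn from
    \<open>even_sum\<close> and not from the factor.\<close>
  then have "even (?q * u)" using even_sum[OF qu] sum_single[OF i(1)] by metis
  then have ev: "odd (u + ?q * u)" using i(2) by simp
  have "single i (u + ?q * u) - single i u \<in> H" using qu by (simp flip: single_diff)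
  then have "u + ?q * u = u" using unique[OF i(1) i(1) ev i(2)] by blast
  then have "?q * u = 0" by simp
  moreover obtain v where "u * v = 1" using odd_word_inverse[OF i(2)] by blast
  ultimately have "?q = 0" by (metis mult.assoc mult.right_neutral mult_zero_left)
  then show False by (simp flip: not_less)
qed

text \<open>Since odd words have order \<open>2^k\<close> modulo \<open>H\<close>, the parity character, viewed as a form
  with values in \<open>2^(k-1) Z_(2^k)\<close>, is determined by multiplication by \<open>2^(k-1)\<close>.\<close>

lemma parity_lifts:
  obtains f where "fn.linear_form f" "\<And>x. x \<in> H \<Longrightarrow> f x = 0"
    "\<And>x. even (f x) \<longleftrightarrow> even (\<Sum>i<n. x i)"
proof -
  let ?q = "2 ^ (LENGTH('k) - 1) :: 'k word"
  let ?G = "{(h + (\<lambda>i. ?q * x i), ?q * (\<Sum>i<n. x i)) | h x. h \<in> H}"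
  have "fn.linear_graph ?G"
    unfolding fn.linear_graph_def
  proof (intro conjI allI impI)
    have "(0 + (\<lambda>i. ?q * 0 i), ?q * (\<Sum>i<n. 0 i)) \<in> ?G" using fn.subspace_0[OF subspace_H] by blast
    then show "(0, 0) \<in> ?G" by (simp flip: zero_fun_def)
  next
    fix x y x' y' assume "(x, y) \<in> ?G" "(x', y') \<in> ?G"
    then obtain h p h' p' where 1: "h \<in> H" "h' \<in> H"
      "x = h + (\<lambda>i. ?q * p i)" "y = ?q * (\<Sum>i<n. p i)"
      "x' = h' + (\<lambda>i. ?q * p' i)" "y' = ?q * (\<Sum>i<n. p' i)" by blast
    have "((h + h') + (\<lambda>i. ?q * (p + p') i), ?q * (\<Sum>i<n. (p + p') i)) \<in> ?G"
      using fn.subspace_add[OF subspace_H 1(1,2)] by blast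
    also have "(h + h') + (\<lambda>i. ?q * (p + p') i) = x + x'"
      by (simp add: 1 fun_eq_iff algebra_simps)
    also have "?q * (\<Sum>i<n. (p + p') i) = y + y'"
      by (simp add: 1 sum.distrib algebra_simps)
    finally show "(x + x', y + y') \<in> ?G" .
  next
    fix c x y assume "(x, y) \<in> ?G"
    then obtain h p where 1: "h \<in> H" "x = h + (\<lambda>i. ?q * p i)" "y = ?q * (\<Sum>i<n. p i)" by blast
    have "((\<lambda>i. c * h i) + (\<lambda>i. ?q * (\<lambda>i. c * p i) i), ?q * (\<Sum>i<n. (\<lambda>i. c * p i) i)) \<in> ?G"
      unfolding mem_Collect_eq
      by (intro exI[of _ "\<lambda>i. c * h i"] exI[of _ "\<lambda>i. c * p i"])
        (simp add: fn.subspace_scale[OF subspace_H 1(1)])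
    also have "(\<lambda>i. c * h i) + (\<lambda>i. ?q * (\<lambda>i. c * p i) i) = (\<lambda>i. c * x i)"
      by (simp add: 1 fun_eq_iff algebra_simps)
    also have "?q * (\<Sum>i<n. (\<lambda>i. c * p i) i) = c * y"
      by (simp add: 1 sum_distrib_left[symmetric] ac_simps)
    finally show "((\<lambda>i. c * x i), c * y) \<in> ?G" .
  next
    fix y assume "(0, y) \<in> ?G"
    then obtain h p where 1: "h \<in> H" "0 = h + (\<lambda>i. ?q * p i)" "y = ?q * (\<Sum>i<n. p i)" by blast
    have "(\<lambda>i. ?q * p i) = - h" using 1(2) by (simp add: eq_neg_iff_add_eq_0 add.commute)
    then have "(\<lambda>i. ?q * p i) \<in> H" using fn.subspace_neg[OF subspace_H 1(1)] by simp
    \<comment> \<open>The form is well defined: a word killed by \<open>?q\<close> modulo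
      \<open>H\<close> has even sum, and \<open>?q\<close> times an even number is 0.\<close>
    then have "even (\<Sum>i<n. p i)" using odd_sum_full_order by blast
    then obtain d where "(\<Sum>i<n. p i) = 2 * d" by (auto simp: dvd_def)
    then have "y = (?q * 2) * d" unfolding 1(3) by (simp only: mult.assoc)
    then show "y = 0" using power_minus_mult[of "LENGTH('k)" "2 :: 'k word"] by simp
  qed
  then obtain f where f: "fn.linear_form f" "\<And>x y. (x, y) \<in> ?G \<Longrightarrow> f x = y"
    by (rule fn.linear_graph_imp_linear_form) blast
  have fH: "f x = 0" if "x \<in> H" for x
  proof -
    have "(x + (\<lambda>i. ?q * 0 i), ?q * (\<Sum>i<n. 0 i)) \<in> ?G" using that by blast
    from f(2)[OF this] show ?thesis by (simp flip: zero_fun_def)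
  qed
  have "even (f x) \<longleftrightarrow> even (\<Sum>i<n. x i)" for x
  proof -
    have "(0 + (\<lambda>i. ?q * x i), ?q * (\<Sum>i<n. x i)) \<in> ?G" using fn.subspace_0[OF subspace_H] by blast
    from f(2)[OF this] have "?q * f x = ?q * (\<Sum>i<n. x i)" by (simp add: fn.linear_form_scale[OF f(1)])
    \<comment> \<open>Cancelling \<open>2^(k-1)\<close> leaves a congruence modulo 2.\<close>
    then have "?q * (f x - (\<Sum>i<n. x i)) = 0" by (simp add: right_diff_distrib)
    then have "2 ^ (LENGTH('k) - (LENGTH('k) - 1)) dvd f x - (\<Sum>i<n. x i)" by (rule pow2_dvd_annihilated)
    moreover have "LENGTH('k) - (LENGTH('k) - 1) = 1" using len_gt_0[where 'a = 'k] by linarith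
    ultimately have "even (f x - (\<Sum>i<n. x i))" by simp
    then show ?thesis by simp
  qed
  with f(1) fH show ?thesis by (rule that)
qed

text \<open>By \<open>zero_mem\<close>, a coset depends only on the first \<open>n\<close> values,
  and these range over a finite set.\<close>

lemma finite_cosets: "finite ((\<lambda>x. {y. y - x \<in> H}) ` N)"
proof (rule finite_subset)
  let ?r = "\<lambda>x i. if i < n then x i else 0 :: 'k word"
  let ?F = "{f. \<forall>i. (i \<in> {..<n} \<longrightarrow> f i \<in> (UNIV :: 'k word set)) \<and> (i \<notin> {..<n} \<longrightarrow> f i = 0)}"
  show "finite ((\<lambda>x. {y. y - x \<in> H}) ` ?F)"
    by (intro finite_imageI finite_set_of_finite_funs) auto
  have "{y. y - x \<in> H} = {y. y - ?r x \<in> H}" for x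
  proof -
    have z: "x - ?r x \<in> H" by (rule zero_mem) simp
    have "y - x \<in> H \<longleftrightarrow> y - ?r x \<in> H" for y
      using fn.subspace_add[OF subspace_H _ z, of "y - x"] fn.subspace_diff[OF subspace_H _ z, of "y - ?r x"]
      by auto
    then show ?thesis by blast
  qed
  moreover have "?r x \<in> ?F" for x by auto
  ultimately show "(\<lambda>x. {y. y - x \<in> H}) ` N \<subseteq> (\<lambda>x. {y. y - x \<in> H}) ` ?F" by blast
qed

text \<open>The unit \<open>v i\<close> moves the class of the \<open>i\<close>-th unit vector into
  the fibre \<open>f = 1\<close>. In coordinates this fibre consists of all admissible lists with
  head 1; \<open>unique\<close> makes the enumeration injective and \<open>cover\<close> makes it
  surjective.\<close>

lemma normalized_coordinates:
  assumes n: "n > 0"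
  obtains f v ws js where
    "fn.coordinate_system H UNIV (f # ws) (LENGTH('k) # js)"
    "sorted js" "set js \<subseteq> {1..LENGTH('k)}"
    "\<And>i. i < n \<Longrightarrow> odd (f (single i 1))"
    "\<And>i. i < n \<Longrightarrow> v i * f (single i 1) = 1"
    "bij_betw (\<lambda>i. map (\<lambda>w. w (single i (v i))) (f # ws)) {..<n}
       {1 # ys | ys. list_all2 (\<lambda>y j. 2 ^ (LENGTH('k) - j) dvd y) ys js}"
proof -
  obtain f where f: "fn.linear_form f" "\<And>x. x \<in> H \<Longrightarrow> f x = 0"
    "\<And>x. even (f x) \<longleftrightarrow> even (\<Sum>i<n. x i)" by (rule parity_lifts) blast
  have odd: "odd (f (single i 1))" if "i < n" for i using f(3) sum_single[OF that] by (metis odd_one)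
  have "\<exists>v. v * f (single i 1) = 1" if "i < n" for i
    using odd_word_inverse[OF odd[OF that]] by (metis mult.commute)
  then obtain v where v: "\<And>i. i < n \<Longrightarrow> v i * f (single i 1) = 1" by metis
  have fv: "f (single i (v i)) = 1" if "i < n" for i
    using linear_form_single[OF f(1), of i "v i" 1] v[OF that] by simp
  let ?N = "UNIV \<inter> {x. f x = 0}"
  obtain ws js where ws: "fn.coordinate_system H ?N ws js" "sorted js" "set js \<subseteq> {1..LENGTH('k)}"
  proof (rule fn.coordinate_system_exists[OF subspace_H, of ?N "LENGTH('k)"])
    show "fn.subspace ?N" using f(1) by (intro fn.subspace_kernel_Int) simp_all
    show "H \<subseteq> ?N" using f(2) by blast
    show "finite ((\<lambda>x. {y. y - x \<in> H}) ` ?N)" by (rule finite_cosets)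
    show "(\<lambda>i. 2 ^ LENGTH('k) * x i) \<in> H" for x by (rule zero_mem) simp
  qed simp_all
  obtain ws' where cs: "fn.coordinate_system H UNIV (f # ws') (LENGTH('k) # js)"
  proof (rule fn.coordinate_system_Cons[OF _ subspace_H f(1,2) _ _ _ _ _ ws(1)])
    \<comment> \<open>Any element with \<open>f = 1\<close> generates a complement of
      \<open>ker f\<close> modulo \<open>H\<close>; coordinate 0 is available because
      \<open>n > 0\<close>.\<close>
    show "f (single 0 (v 0)) = 2 ^ (LENGTH('k) - LENGTH('k))" using fv n by simp
    show "(\<lambda>i. 2 ^ LENGTH('k) * single 0 (v 0) i) \<in> H" by (rule zero_mem) simp
  qed simp_all
  let ?col = "\<lambda>i. map (\<lambda>w. w (single i (v i))) (f # ws')"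
  have lin: "fn.linear_form w" if "w \<in> set (f # ws')" for w
    using cs that by (auto simp: fn.coordinate_system_def)
  have ker: "x \<in> H" if "\<And>w. w \<in> set (f # ws') \<Longrightarrow> w x = 0" for x
    using cs that by (simp add: fn.coordinate_system_def)
  have ker': "w x = 0" if "w \<in> set (f # ws')" "x \<in> H" for w x
    using cs that by (auto simp: fn.coordinate_system_def)
  have oddv: "odd (v i)" if "i < n" for i
    using v[OF that] by (metis dvd_mult2 odd_one)
  have "bij_betw ?col {..<n} {1 # ys | ys. list_all2 (\<lambda>y j. 2 ^ (LENGTH('k) - j) dvd y) ys js}"
    unfolding bij_betw_def
  proof (intro conjI inj_onI equalityI subsetI)
    fix i j assume ij: "i \<in> {..<n}" "j \<in> {..<n}" "?col i = ?col j"
    have "single i (v i) - single j (v j) \<in> H"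
    proof (rule ker)
      fix w assume w: "w \<in> set (f # ws')"
      then have "w (single i (v i)) = w (single j (v j))" using ij(3) by auto
      then show "w (single i (v i) - single j (v j)) = 0" by (simp add: fn.linear_form_diff[OF lin[OF w]])
    qed
    then show "i = j" using unique[OF _ _ oddv oddv] ij(1,2) by blast
  next
    fix c :: "'k word list" assume "c \<in> ?col ` {..<n}"
    then obtain i where i: "i < n" "c = ?col i" by blast
    have "list_all2 (\<lambda>w j. 2 ^ (LENGTH('k) - j) dvd w (single i (v i))) (f # ws') (LENGTH('k) # js)"
      using cs by (simp add: fn.coordinate_system_def)
    then show "c \<in> {1 # ys | ys. list_all2 (\<lambda>y j. 2 ^ (LENGTH('k) - j) dvd y) ys js}"
      using i fv by (simp add: list_all2_map1)
  next
    fix c :: "'k word list" assume "c \<in> {1 # ys | ys. list_all2 (\<lambda>y j. 2 ^ (LENGTH('k) - j) dvd y) ys js}"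
    then have c: "list_all2 (\<lambda>y j. 2 ^ (LENGTH('k) - j) dvd y) c (LENGTH('k) # js)" and hd: "hd c = 1" by auto
    \<comment> \<open>Any word with the prescribed coordinates has \<open>f x = 1\<close>, hence odd
      sum, so \<open>cover\<close> reduces it to some \<open>single i u\<close>; then
      \<open>f\<close> forces \<open>u = v i\<close>.\<close>
    obtain x where x: "map (\<lambda>w. w x) (f # ws') = c"
      by (rule fn.coordinate_system_surj[OF cs c]) (rule that)
    then have "f x = 1" using hd by auto
    then have "odd (\<Sum>i<n. x i)" using f(3) by (metis odd_one)
    then obtain i u where i: "i < n" "odd u" "x - single i u \<in> H" using cover by blast
    have eq: "w x = w (single i u)" if "w \<in> set (f # ws')" for w
      using ker'[OF that i(3)] by (simp add: fn.linear_form_diff[OF lin[OF that]])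
    have "u * f (single i 1) = 1" using eq[of f] \<open>f x = 1\<close> linear_form_single[OF f(1), of i u 1] by simp
    then have "u = v i" using v[OF i(1)] by (metis mult.commute mult.left_commute mult.right_neutral)
    have "c = ?col i" unfolding x[symmetric] using eq by (auto simp: \<open>u = v i\<close>)
    then show "c \<in> ?col ` {..<n}" using i(1) by blast
  qed
  with cs ws(2,3) odd v show ?thesis by (rule that)
qed

end

subsection \<open>The columns of the parity-check matrix\<close>

lemma length_product_lists: "length (product_lists xss) = prod_list (map length xss)"
proof (induction xss)
  case (Cons xs xss)
  then show ?case by (simp add: length_concat o_def sum_list_triv)
qed simp

text \<open>Only the remainder of the cofactor modulo \<open>2^j\<close> matters, since
  \<open>2^(k-j) * 2^j = 0\<close>.\<close>

lemma range_multiples: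
  assumes "j \<le> LENGTH('k)"
  shows "range (\<lambda>x :: 'k::len word. 2 ^ (LENGTH('k) - j) * x) =
    (\<lambda>i. 2 ^ (LENGTH('k) - j) * of_nat i) ` {..<2 ^ j}"
proof (intro equalityI subsetI)
  fix y assume "y \<in> range (\<lambda>x :: 'k word. 2 ^ (LENGTH('k) - j) * x)"
  then obtain x :: "'k word" where y: "y = 2 ^ (LENGTH('k) - j) * x" by blast
  have "x = of_nat (2 ^ j * (unat x div 2 ^ j) + unat x mod 2 ^ j)" by simp
  then have "y = 2 ^ (LENGTH('k) - j) * (2 ^ j * of_nat (unat x div 2 ^ j) + of_nat (unat x mod 2 ^ j))"
    unfolding y by (simp only: of_nat_add of_nat_mult of_nat_power of_nat_numeral)
  also have "\<dots> = 2 ^ (LENGTH('k) - j + j) * of_nat (unat x div 2 ^ j)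
      + 2 ^ (LENGTH('k) - j) * of_nat (unat x mod 2 ^ j)"
    by (simp only: distrib_left power_add mult.assoc)
  also have "\<dots> = 2 ^ (LENGTH('k) - j) * of_nat (unat x mod 2 ^ j)" using assms by simp
  finally show "y \<in> (\<lambda>i. 2 ^ (LENGTH('k) - j) * of_nat i) ` {..<2 ^ j}" by (intro image_eqI) auto
qed auto

text \<open>For \<open>i < 2^j\<close> the products \<open>2^(k-j) * i\<close> stay below
  \<open>2^k\<close>, so no wraparound identifies two of them.\<close>

lemma length_multiples_list:
  assumes "j \<le> LENGTH('k)"
  shows "length (multiples_list j :: 'k::len word list) = 2 ^ j"
proof -
  have "inj_on (\<lambda>i. 2 ^ (LENGTH('k) - j) * of_nat i :: 'k word) {..<2 ^ j}"
  proof (rule inj_onI)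
    fix a b :: nat assume ab: "a \<in> {..<2 ^ j}" "b \<in> {..<2 ^ j}"
      and "2 ^ (LENGTH('k) - j) * of_nat a = (2 ^ (LENGTH('k) - j) * of_nat b :: 'k word)"
    then have eq: "(of_nat (2 ^ (LENGTH('k) - j) * a) :: 'k word) = of_nat (2 ^ (LENGTH('k) - j) * b)" by simp
    have lt: "2 ^ (LENGTH('k) - j) * c < 2 ^ LENGTH('k)" if "c < 2 ^ j" for c :: nat
    proof -
      have "2 ^ (LENGTH('k) - j) * c < 2 ^ (LENGTH('k) - j) * 2 ^ j" using that by simp
      then show ?thesis using assms by (simp flip: power_add)
    qed
    have "2 ^ (LENGTH('k) - j) * a = 2 ^ (LENGTH('k) - j) * b"
      using arg_cong[OF eq, of unat] lt[of a] lt[of b] ab by (simp add: unat_of_nat del: of_nat_mult)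
    then show "a = b" by simp
  qed
  then show ?thesis by (simp add: multiples_list_def range_multiples[OF assms] card_image)
qed

text \<open>Both lists are sorted and have the same multiset of entries. This matches the order of
  the factors in \<open>column_factors\<close> with a sorted list of orders.\<close>

lemma concat_replicate_count_list:
  fixes js L :: "'a::linorder list"
  assumes "sorted js" "set js \<subseteq> set L" "sorted L" "distinct L"
  shows "concat (map (\<lambda>j. replicate (count_list js j) j) L) = js"
proof -
  have c: "count_list (concat (map (\<lambda>j. replicate (g j) j) L)) x = (if x \<in> set L then g x else 0)" for g x
    using assms(4)
  proof (induction L)
    case (Cons a L)
    have "count_list (replicate m a) x = (if x = a then m else 0)" for m by (induction m) auto
    then show ?case using Cons by auto
  qed simp
  have s: "sorted (concat (map (\<lambda>j. replicate (g j) j) L))" for g :: "'a \<Rightarrow> nat"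
    using assms(3) by (induction L) (auto simp: sorted_append)
  have "mset (concat (map (\<lambda>j. replicate (count_list js j) j) L)) = mset js"
    using assms(2) by (intro multiset_eqI) (auto simp: count_mset c count_list_0_iff)
  then show ?thesis using s assms(1) by (metis properties_for_sort)
qed

lemma column_factors_count_list:
  assumes "sorted js" "set js \<subseteq> {1..LENGTH('k)}"
  shows "(column_factors (count_list js) :: 'k::len word list list) = [1] # map multiples_list js"
proof -
  have "concat (map (\<lambda>j. replicate (count_list js j) (multiples_list j)) [1..<LENGTH('k) + 1]) =
    map multiples_list (concat (map (\<lambda>j. replicate (count_list js j) j) [1..<LENGTH('k) + 1]))"
    by (simp only: map_concat map_map o_def map_replicate)
  also have "concat (map (\<lambda>j. replicate (count_list js j) j) [1..<LENGTH('k) + 1]) = js"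
    using assms by (intro concat_replicate_count_list) (auto simp del: upt_Suc)
  finally show ?thesis unfolding column_factors_def by simp
qed

text \<open>The number of columns is the product of the factor sizes \<open>2^j\<close> over
  \<open>js\<close>; grouping equal exponents turns the sum of \<open>js\<close> into the weighted
  sum of multiplicities.\<close>

lemma
  assumes "sorted js" "set js \<subseteq> {1..LENGTH('k)}"
  shows length_columns_count_list:
      "length (columns (count_list js) :: 'k::len word list list) = 2 ^ (\<Sum>j=1..LENGTH('k). j * count_list js j)"
    and set_columns_count_list:
      "set (columns (count_list js) :: 'k word list list) =
        {1 # ys | ys. list_all2 (\<lambda>y j. 2 ^ (LENGTH('k) - j) dvd y) ys js}"
    and sum_count_list: "(\<Sum>j=1..LENGTH('k). count_list js j) = length js"
proof -
  have "length (columns (count_list js) :: 'k word list list) = prod_list (map (\<lambda>j. length (multiples_list j :: 'k word list)) js)"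
    by (simp add: columns_def column_factors_count_list[OF assms] length_product_lists o_def)
  also have "\<dots> = prod_list (map (\<lambda>j. 2 ^ j) js)"
    using assms(2) by (intro arg_cong[where f = prod_list] map_cong refl length_multiples_list) auto
  also have "\<dots> = 2 ^ sum_list js" by (induction js) (auto simp: power_add)
  also have "sum_list js = (\<Sum>j=1..LENGTH('k). count_list js j * j)"
    using sum_list_map_eq_sum_count2[OF assms(2), of "\<lambda>j. j"] by simp
  finally show "length (columns (count_list js) :: 'k word list list) = 2 ^ (\<Sum>j=1..LENGTH('k). j * count_list js j)"
    by (simp add: mult.commute)
  show "(\<Sum>j=1..LENGTH('k). count_list js j) = length js"
    using sum_count_set[OF assms(2)] by simp
  show "set (columns (count_list js) :: 'k word list list) =
        {1 # ys | ys. list_all2 (\<lambda>y j. 2 ^ (LENGTH('k) - j) dvd y) ys js}"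
    unfolding set_columns column_factors_count_list[OF assms]
    by (auto simp: list_all2_Cons2 list_all2_map2 set_multiples_list dvd_def elim!: list_all2_mono)
qed

lemma distinct_columns: "distinct (columns I :: 'k::len word list list)"
  unfolding columns_def
  by (rule distinct_product_lists) (auto simp: column_factors_def multiples_list_def)

subsection \<open>From codes to subspaces\<close>

text \<open>Each entry has the same parity as its weight, so the parts of the graph are described by
  a linear parity condition.\<close>

lemma even_weight_diamond: "even (weight_diamond x) \<longleftrightarrow> even (\<Sum>i<dim_vec x. x $ i)"
proof -
  have "even (\<Sum>i\<in>A. wt_diamond (x $ i)) \<longleftrightarrow> even (\<Sum>i\<in>A. x $ i)" for A
    by (induction A rule: infinite_finite_induct) (auto simp: wt_diamond_def)
  then show ?thesis by (simp add: weight_diamond_def)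
qed

lemma adjacentD:
  assumes "adjacent x y" "dim_vec x = n"
  obtains i where "i < n" "odd (y $ i - x $ i)" "\<And>j. j < n \<Longrightarrow> j \<noteq> i \<Longrightarrow> y $ j = x $ j"
proof -
  from assms have "\<exists>i\<in>{..<n}. wt_diamond (y $ i - x $ i) = 1 \<and> (\<forall>j\<in>{..<n}. i \<noteq> j \<longrightarrow> wt_diamond (y $ j - x $ j) = 0)"
    by (simp add: adjacent_def dist_diamond_def sum_eq_Suc0_iff)
  then obtain i where i: "i < n" "wt_diamond (y $ i - x $ i) = 1"
    "\<And>j. j < n \<Longrightarrow> i \<noteq> j \<Longrightarrow> wt_diamond (y $ j - x $ j) = 0" by auto
  show ?thesis
  proof (rule that[of i])
    show "odd (y $ i - x $ i)" using i(2) by (auto simp: wt_diamond_def split: if_splits)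
    show "y $ j = x $ j" if "j < n" "j \<noteq> i" for j
      using i(3)[OF that(1)] that(2) by (auto simp: wt_diamond_def split: if_splits)
  qed (rule i)
qed

lemma adjacentI:
  assumes "i < dim_vec x" "odd (y $ i - x $ i)" "\<And>j. j < dim_vec x \<Longrightarrow> j \<noteq> i \<Longrightarrow> y $ j = x $ j"
  shows "adjacent x y"
proof -
  have "dist_diamond x y = (\<Sum>j<dim_vec x. if j = i then 1 else 0)"
    unfolding dist_diamond_def using assms by (intro sum.cong) (auto simp: wt_diamond_def)
  then show ?thesis using assms(1) by (simp add: adjacent_def)
qed

text \<open>The existence half of perfectness yields \<open>cover\<close>. For
  \<open>unique\<close>, the odd word \<open>single i u\<close> is adjacent both to 0 and to
  \<open>single i u - single j v\<close>, so if the latter is a codeword, it is 0.\<close>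

lemma perfect_subspace_of_code:
  assumes lin: "linear_code n (H :: 'k::len word vec set)" and perf: "one_prime_perfect n H"
  shows "perfect_subspace n {x. vec n x \<in> H}"
proof -
  have carr: "H \<subseteq> carrier_vec n" and zero: "0\<^sub>v n \<in> H"
    and add: "\<And>v w. v \<in> H \<Longrightarrow> w \<in> H \<Longrightarrow> v + w \<in> H"
    and smult: "\<And>c v. v \<in> H \<Longrightarrow> c \<cdot>\<^sub>v v \<in> H"
    using lin by (auto simp: linear_code_iff)
  have ev: "even (\<Sum>i<n. x i)" if "vec n x \<in> H" for x
  proof -
    have "even (weight_diamond (vec n x))"
      using perf that by (auto simp: one_prime_perfect_def even_part_def)
    then show ?thesis by (simp add: even_weight_diamond)
  qed
  have ex1: "\<exists>!c. c \<in> H \<and> adjacent (vec n x) c" if "odd (\<Sum>i<n. x i)" for x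
    using perf that by (simp add: one_prime_perfect_def odd_part_def even_weight_diamond)
  show ?thesis
  proof
    show "fn.subspace {x. vec n x \<in> H}"
      unfolding fn.subspace_def
    proof (intro conjI ballI allI; simp only: mem_Collect_eq)
      have "vec n 0 = (0\<^sub>v n :: 'k word vec)" by auto
      then show "vec n 0 \<in> H" using zero by simp
      fix x assume x: "vec n x \<in> H"
      have "vec n (\<lambda>i. c * x i) = c \<cdot>\<^sub>v vec n x" for c by auto
      then show "vec n (\<lambda>i. c * x i) \<in> H" for c using smult[OF x] by simp
      fix y assume y: "vec n y \<in> H"
      have "vec n (x + y) = vec n x + vec n y" by auto
      then show "vec n (x + y) \<in> H" using add[OF x y] by simp
    qed
    show "x \<in> {x. vec n x \<in> H}" if "\<And>i. i < n \<Longrightarrow> x i = 0" for x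
    proof -
      have "vec n x = 0\<^sub>v n" using that by auto
      then show ?thesis using zero by simp
    qed
    show "even (\<Sum>i<n. x i)" if "x \<in> {x. vec n x \<in> H}" for x using that ev by simp
  next
    fix x :: "nat \<Rightarrow> 'k word" assume "odd (\<Sum>i<n. x i)"
    then obtain c where c: "c \<in> H" "adjacent (vec n x) c" using ex1 by blast
    from c(2) obtain i where i: "i < n" "odd (c $ i - vec n x $ i)"
      "\<And>j. j < n \<Longrightarrow> j \<noteq> i \<Longrightarrow> c $ j = vec n x $ j" by (rule adjacentD) (simp, blast)
    have dim: "dim_vec c = n" using c(1) carr by auto
    have "vec n (x - single i (x i - c $ i)) = c"
      using i dim by (intro eq_vecI) (auto simp: single_def)
    moreover have "odd (x i - c $ i)" using i(1,2) by simp
    ultimately show "\<exists>i<n. \<exists>u. odd u \<and> x - single i u \<in> {x. vec n x \<in> H}"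
      using i(1) c(1) by (intro exI[of _ i] conjI exI[of _ "x i - c $ i"]) simp_all
  next
    fix i j :: nat and u v :: "'k word"
    assume ij: "i < n" "j < n" "odd u" "odd v" and "single i u - single j v \<in> {x. vec n x \<in> H}"
    then have d: "vec n (single i u - single j v) \<in> H" by simp
    have "odd (\<Sum>l<n. single i u l)" using sum_single[OF ij(1), of u] ij(3) by simp
    then have e: "\<exists>!c. c \<in> H \<and> adjacent (vec n (single i u)) c" by (rule ex1)
    have "adjacent (vec n (single i u)) (0\<^sub>v n)"
      using ij by (intro adjacentI[of i]) (auto simp: single_def)
    moreover have "adjacent (vec n (single i u)) (vec n (single i u - single j v))"
      using ij by (intro adjacentI[of j]) (auto simp: single_def)
    ultimately have eq: "vec n (single i u - single j v) = 0\<^sub>v n" using e d zero by blast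
    have "single i u l = single j v l" if "l < n" for l
      using arg_cong[OF eq, of "\<lambda>w. w $ l"] that by simp
    from this[OF ij(1)] this[OF ij(2)] show "i = j \<and> u = v"
      using ij(3,4) by (auto simp: single_def split: if_splits)
  qed
qed

section \<open>The permutation and the unit multipliers taking the code to
  \<open>parity_check_code I\<close>\<close>

theorem theorem4:
  fixes n r :: nat and H :: "'k::len word vec set"
  assumes "n = 2 ^ r"
    and "linear_code n H"
    and "one_prime_perfect n H"
  shows "\<exists>I :: nat \<Rightarrow> nat. (\<Sum>j=1..LENGTH('k). j * I j) = r \<and>
           equivalent_codes n H (parity_check_code I)"
proof -
  have carr: "H \<subseteq> carrier_vec n" using assms(2) by (simp add: linear_code_iff)
  let ?H = "{x. vec n x \<in> H}"
  interpret perfect_subspace n ?H using assms(2,3) by (rule perfect_subspace_of_code)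
  have n: "n > 0" using assms(1) by simp
  obtain f v ws js where cs: "fn.coordinate_system ?H UNIV (f # ws) (LENGTH('k) # js)"
    and js: "sorted js" "set js \<subseteq> {1..LENGTH('k)}"
    and oddf: "\<And>i. i < n \<Longrightarrow> odd (f (single i 1))"
    and v: "\<And>i. i < n \<Longrightarrow> v i * f (single i 1) = 1"
    and bij: "bij_betw (\<lambda>i. map (\<lambda>w. w (single i (v i))) (f # ws)) {..<n}
       {1 # ys | ys. list_all2 (\<lambda>y j. 2 ^ (LENGTH('k) - j) dvd y) ys js}"
    by (rule normalized_coordinates[OF n]) blast
  define I where "I = count_list js"
  let ?cols = "columns I :: 'k word list list"
  let ?col = "\<lambda>i. map (\<lambda>w. w (single i (v i))) (f # ws)"
  have set_cols: "bij_betw ?col {..<n} (set ?cols)"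
    using bij unfolding I_def set_columns_count_list[OF js] .
  have dist: "distinct ?cols" by (rule distinct_columns)
  \<comment> \<open>Both the indices below \<open>n\<close> and the columns enumerate the fibre
    \<open>f = 1\<close>; comparing the two counts as powers of two yields the weighted sum
    \<open>r\<close>.\<close>
  have len: "length ?cols = n"
    using bij_betw_same_card[OF set_cols] distinct_card[OF dist] by simp
  then have "2 ^ (\<Sum>j=1..LENGTH('k). j * I j) = (2 :: nat) ^ r"
    unfolding I_def length_columns_count_list[OF js] assms(1) .
  then have r: "(\<Sum>j=1..LENGTH('k). j * I j) = r" by simp
  have len_ws: "length ws = length js"
    using cs list_all2_lengthD unfolding fn.coordinate_system_def by fastforce
  have nth_cols: "bij_betw ((!) ?cols) {..<n} (set ?cols)"
    using len dist by (intro bij_betw_nth) auto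
  \<comment> \<open>\<open>p i\<close> is the index whose normalized class is the
    \<open>i\<close>-th column; the identity beyond \<open>n\<close> is what \<open>permutes\<close>
    demands.\<close>
  define p where "p i = (if i < n then the_inv_into {..<n} ?col (?cols ! i) else i)" for i
  have "bij_betw (the_inv_into {..<n} ?col \<circ> (!) ?cols) {..<n} {..<n}"
    using nth_cols bij_betw_the_inv_into[OF set_cols] by (rule bij_betw_trans)
  then have "bij_betw p {..<n} {..<n}" by (subst bij_betw_cong) (auto simp: p_def)
  then have p: "p permutes {..<n}" by (rule bij_imp_permutes) (simp add: p_def)
  have pn: "p i < n \<longleftrightarrow> i < n" for i using permutes_in_image[OF p, of i] by simp
  have cols_p: "?cols ! i = ?col (p i)" if "i < n" for i
    using that len f_the_inv_into_f_bij_betw[OF set_cols, of "?cols ! i"] by (simp add: p_def)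
  \<comment> \<open>These multipliers are inverse to the units \<open>v (p i)\<close> and cancel the
    normalization of the columns.\<close>
  define z where "z = vec n (\<lambda>i. f (single (p i) 1))"
  let ?T = "\<lambda>x. z \<circ>\<^sub>v permute_coords p x"
  have T: "?T x \<in> carrier_vec n" if "x \<in> carrier_vec n" for x
    using that by (auto simp: coord_prod_def permute_coords_def)
  have T_nth: "?T x $ i = f (single (p i) 1) * x $ p i" if "x \<in> carrier_vec n" "i < n" for x i
    using that by (simp add: coord_prod_def permute_coords_def z_def)
  have lin: "fn.linear_form w" if "w \<in> set (f # ws)" for w
    using cs that by (auto simp: fn.coordinate_system_def)
  have ker: "x \<in> ?H \<longleftrightarrow> (\<forall>w\<in>set (f # ws). w x = 0)" for x
    using cs unfolding fn.coordinate_system_def by blast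
  let ?m = "1 + (\<Sum>j=1..LENGTH('k). I j)"
  let ?B = "check_matrix I :: 'k word mat"
  have m: "?m = length (f # ws)" using sum_count_list[OF js] len_ws by (simp add: I_def)
  have B: "?B \<in> carrier_mat ?m n" using len by (auto simp: check_matrix_def)
  have B_nth: "?B $$ (t, i) = ((f # ws) ! t) (single (p i) (v (p i)))" if "t < ?m" "i < n" for t i
  proof -
    have "?B $$ (t, i) = ?cols ! i ! t"
      using that len by (simp add: check_matrix_def mat_of_cols_index vec_of_list_index)
    also have "\<dots> = ((f # ws) ! t) (single (p i) (v (p i)))"
      unfolding cols_p[OF that(2)] using that(1) unfolding m by (rule nth_map)
    finally show ?thesis .
  qed
  \<comment> \<open>The syndrome of the transformed word is the list of coordinates of the class of
    \<open>x\<close>, so it vanishes exactly on the code.\<close>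
  have B_T: "(?B *\<^sub>v ?T x) $ t = ((f # ws) ! t) (($) x)" if x: "x \<in> carrier_vec n" and t: "t < ?m" for x t
  proof -
    let ?w = "(f # ws) ! t"
    have w: "?w \<in> set (f # ws)" using t unfolding m by (rule nth_mem)
    have "(?B *\<^sub>v ?T x) $ t = (\<Sum>i<n. ?B $$ (t, i) * ?T x $ i)"
      using t B T[OF x] by (auto simp: scalar_prod_def lessThan_atLeast0 intro!: sum.cong)
    also have "\<dots> = (\<Sum>i<n. ?w (single (p i) (x $ p i)))"
    proof (intro sum.cong refl)
      fix i assume "i \<in> {..<n}"
      then have i: "i < n" "p i < n" using pn by auto
      have "?w (single (p i) (v (p i))) = v (p i) * ?w (single (p i) 1)"
        using linear_form_single[OF lin[OF w], of "p i" "v (p i)" 1] by simp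
      then have "?B $$ (t, i) * ?T x $ i = (v (p i) * f (single (p i) 1)) * (x $ p i * ?w (single (p i) 1))"
        unfolding B_nth[OF t i(1)] T_nth[OF x i(1)] by (simp only: ac_simps)
      also have "\<dots> = ?w (single (p i) (x $ p i))"
        using linear_form_single[OF lin[OF w], of "p i" "x $ p i" 1] v[OF i(2)] by simp
      finally show "?B $$ (t, i) * ?T x $ i = ?w (single (p i) (x $ p i))" .
    qed
    also have "\<dots> = (\<Sum>i<n. ?w (single i (x $ i)))"
      by (rule sum.permute[OF p, unfolded o_def, symmetric])
    also have "\<dots> = ?w (\<Sum>i<n. single i (x $ i))" by (rule fn.linear_form_sum[OF lin[OF w], symmetric])
    also have "\<dots> = ?w (($) x)"
    proof -
      have s: "(\<Sum>i\<in>A. single i (x $ i)) l = (\<Sum>i\<in>A. single i (x $ i) l)" for A l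
        by (induction A rule: infinite_finite_induct) auto
      \<comment> \<open>The function \<open>($) x\<close> has unspecified values beyond
        \<open>n\<close>; its expansion agrees with it below \<open>n\<close>, and the forms vanish
        on the difference.\<close>
      have "($) x - (\<Sum>i<n. single i (x $ i)) \<in> ?H"
      proof (rule zero_mem)
        fix l assume "l < n"
        then have "(\<Sum>i<n. single i (x $ i) l) = x $ l" by (simp add: single_def)
        then show "(($) x - (\<Sum>i<n. single i (x $ i))) l = 0" by (simp add: s)
      qed
      then have "?w (($) x - (\<Sum>i<n. single i (x $ i))) = 0" using ker w by blast
      then show ?thesis by (simp add: fn.linear_form_diff[OF lin[OF w]])
    qed
    finally show ?thesis .
  qed
  have mem: "?T x \<in> parity_check_code I \<longleftrightarrow> x \<in> H" if x: "x \<in> carrier_vec n" for x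
  proof -
    have "?T x \<in> parity_check_code I \<longleftrightarrow> ?B *\<^sub>v ?T x = 0\<^sub>v ?m"
      using T[OF x] by (simp add: parity_check_code_def mat_kernel[OF B])
    also have "\<dots> \<longleftrightarrow> (\<forall>t<?m. (?B *\<^sub>v ?T x) $ t = 0)"
      using B by (auto simp: vec_eq_iff)
    also have "\<dots> \<longleftrightarrow> (\<forall>t<length (f # ws). ((f # ws) ! t) (($) x) = 0)"
      using B_T[OF x] by (simp only: m cong: imp_cong)
    also have "\<dots> \<longleftrightarrow> (\<forall>w\<in>set (f # ws). w (($) x) = 0)" by (simp only: all_set_conv_all_nth)
    also have "\<dots> \<longleftrightarrow> vec n (($) x) \<in> H" using ker[of "($) x"] by simp
    also have "vec n (($) x) = x" using x by auto
    finally show ?thesis .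
  qed
  have "parity_check_code I = ?T ` H"
  proof (intro equalityI subsetI)
    fix y :: "'k word vec" assume y: "y \<in> parity_check_code I"
    then have yn: "y \<in> carrier_vec n" by (simp add: parity_check_code_def mat_kernel[OF B])
    \<comment> \<open>The preimage undoes the permutation by the inverse of \<open>p\<close> and the
      scaling by the units \<open>v i\<close>.\<close>
    define x where "x = vec n (\<lambda>i. v i * y $ inv_into UNIV p i)"
    have x: "x \<in> carrier_vec n" by (simp add: x_def)
    have "?T x = y"
    proof (rule eq_vecI)
      fix i assume "i < dim_vec y"
      then have i: "i < n" "p i < n" using yn pn by auto
      have "?T x $ i = (v (p i) * f (single (p i) 1)) * y $ i"
        unfolding T_nth[OF x i(1)] using i by (simp add: x_def permutes_inverses[OF p] ac_simps)
      then show "?T x $ i = y $ i" using v[OF i(2)] by simp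
    qed (use T[OF x] yn in auto)
    then show "y \<in> ?T ` H" using mem[OF x] y by blast
  next
    fix y :: "'k word vec" assume "y \<in> ?T ` H"
    then show "y \<in> parity_check_code I" using mem carr by blast
  qed
  moreover have "\<forall>i<n. odd (z $ i)" using oddf pn by (simp add: z_def)
  moreover have "z \<in> carrier_vec n" by (simp add: z_def)
  ultimately have "equivalent_codes n H (parity_check_code I)"
    using p unfolding equivalent_codes_def by blast
  with r show ?thesis by blast
qed

end
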